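(* Crushing an arbitrary finite number of normal surfaces in a triangulation increases the treewidth by at most a multiplicative factor of six: if $\mathfrak{T}$ is a triangulation of a 3-manifold and $\mathfrak{T}^*$ is obtained from $\mathfrak{T}$ by a finite sequence of crushings of normal surfaces (each one performed in the current triangulation), then $\operatorname{tw}(\mathfrak{T}^* )\le 6\operatorname{tw}(\mathfrak{T})$.
   Context: Triangulations. A generalised triangulation is a finite pairwise-disjoint collection of abstract tetrahedra together with affine maps identifying triangular faces in pairs (two faces of the same tetrahedron may be glued, and two tetrahedra may be glued along several faces); the quotient is the underlying 3-manifold. In a bounded triangulation some faces are left unglued and form the boundary; in an ideal triangulation vertices are removed. "Triangulation" here means any of these. The dual graph has one node per tetrahedron and one arc per face gluing (loops and multiple arcs allowed). Treewidth. A tree decomposition of a graph $G$ consists of a tree $X$ and, for each node $\tau$ of $X$, a bag $B_\tau$ of nodes of $G$, such that: (1) each node of $G$ belongs to some bag; (2) for every arc $(u,v)$ of $G$ some bag contains both $u$ and $v$; (3) for each node $u$ of $G$ the bags containing $u$ form a connected subtree of $X$. Its width is $\max_{\tau}|B_\tau|-1$. The treewidth $\operatorname{tw}(G)$ is the smallest width of a tree decomposition of $G$; the treewidth $\operatorname{tw}(\mathfrak{T})$ of a triangulation is the treewidth of its dual graph. Normal surfaces and crushing. A normal surface in $\mathfrak{T}$ is a properly embedded surface meeting each tetrahedron in a (possibly empty) finite disjoint collection of normal discs: curvilinear triangles (each separating one vertex of the tetrahedron from the other three) and quads (each separating two vertices from the other two). Crushing $\mathfrak{T}$ along $S$ is the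 following procedure. (1) Cut $\mathfrak{T}$ open along $S$, obtaining a cell decomposition. (2) Collapse each of the resulting copies of $S$ to a point, using the quotient topology. Each tetrahedron of $\mathfrak{T}$ containing no quad of $S$ yields one (central) tetrahedron and possibly some 3-sided footballs (cells with two vertices, three edges joining them, and three bigon faces); each tetrahedron containing quads of $S$ yields two triangular purses (cells with two triangular faces, sharing a common edge, whose remaining pairs of corresponding edges bound two bigon faces) and possibly some 3-sided and 4-sided footballs. (3) Flatten all non-tetrahedron cells: every football (and every bigon) is flattened to an edge, and every triangular purse is flattened to a triangle, identifying its two triangular faces. Finally, separate tetrahedra joined only along pinched vertices or edges. The result is the triangulation formed by the surviving tetrahedra with their induced face gluings. *)

theory Defs
  imports "HOL-Analysis.Analysis"
begin

section \<open>Treewidth\<close>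

record ('v, 'e) multigraph =
  nodes :: "'v set"
  arcs :: "'e set"
  ends :: "'e \<Rightarrow> 'v set"   \<comment> \<open>a singleton for a loop\<close>

definition connected_on :: "'n set set \<Rightarrow> 'n set \<Rightarrow> bool" where
  "connected_on E N \<longleftrightarrow>
     (\<forall>u\<in>N. \<forall>v\<in>N. (\<lambda>a b. a \<in> N \<and> b \<in> N \<and> {a, b} \<in> E)\<^sup>*\<^sup>* u v)"

definition is_cycle :: "'n set set \<Rightarrow> 'n list \<Rightarrow> bool" where
  "is_cycle E xs \<longleftrightarrow> 3 \<le> length xs \<and> distinct xs \<and>
     (\<forall>i<length xs. {xs ! i, xs ! ((i + 1) mod length xs)} \<in> E)"

definition is_tree :: "'n set \<Rightarrow> 'n set set \<Rightarrow> bool" where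
  "is_tree N E \<longleftrightarrow> finite N \<and> N \<noteq> {} \<and> E \<subseteq> {{u, v} |u v. u \<in> N \<and> v \<in> N \<and> u \<noteq> v} \<and>
     connected_on E N \<and> \<not> (\<exists>xs. is_cycle E xs)"

definition tree_decomposition ::
  "('v, 'e) multigraph \<Rightarrow> 'n set \<Rightarrow> 'n set set \<Rightarrow> ('n \<Rightarrow> 'v set) \<Rightarrow> bool" where
  "tree_decomposition G N E B \<longleftrightarrow>
     is_tree N E \<and>
     (\<forall>\<tau>\<in>N. B \<tau> \<subseteq> nodes G) \<and>
     (\<forall>u\<in>nodes G. \<exists>\<tau>\<in>N. u \<in> B \<tau>) \<and>
     (\<forall>e\<in>arcs G. \<exists>\<tau>\<in>N. ends G e \<subseteq> B \<tau>) \<and>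
     (\<forall>u\<in>nodes G. connected_on E {\<tau> \<in> N. u \<in> B \<tau>})"

text \<open>Subtraction of natural numbers makes the width 0, rather than \<open>-1\<close>, when all bags are empty;
  this affects only the treewidth of the empty graph.\<close>

definition width :: "'n set \<Rightarrow> ('n \<Rightarrow> 'v set) \<Rightarrow> nat" where
  "width N B = Max ((\<lambda>\<tau>. card (B \<tau>)) ` N) - 1"

text \<open>Every finite tree is isomorphic to one whose nodes are natural numbers.\<close>

definition treewidth :: "('v, 'e) multigraph \<Rightarrow> nat" where
  "treewidth G =
     (LEAST w. \<exists>(N :: nat set) E B. tree_decomposition G N E B \<and> width N B = w)"


section \<open>Generalised triangulations\<close>

text \<open>The vertices of every tetrahedron are labelled by the four-element type \<open>4\<close>, and
  \<open>(\<Delta>, f)\<close> stands for the face of the tetrahedron \<open>\<Delta>\<close> opposite its vertex \<open>f\<close>.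
  An entry \<open>(\<Delta>, f, \<Delta>', \<pi>)\<close> glues the face \<open>(\<Delta>, f)\<close> to the face \<open>(\<Delta>', \<pi> f)\<close> by the affine
  map that sends each vertex \<open>v \<noteq> f\<close> of \<open>\<Delta>\<close> to the vertex \<open>\<pi> v\<close> of \<open>\<Delta>'\<close>. Every gluing is
  listed in both directions. Faces without an entry are boundary faces.\<close>

record 'a triangulation =
  tets :: "'a set"
  gluings :: "('a \<times> 4 \<times> 'a \<times> (4 \<Rightarrow> 4)) set"

definition triangulation :: "'a triangulation \<Rightarrow> bool" where
  "triangulation T \<longleftrightarrow> finite (tets T) \<and>
     (\<forall>\<Delta> f \<Delta>' \<pi>. (\<Delta>, f, \<Delta>', \<pi>) \<in> gluings T \<longrightarrow>
        \<Delta> \<in> tets T \<and> \<Delta>' \<in> tets T \<and> bij \<pi> \<and> (\<Delta>', \<pi> f) \<noteq> (\<Delta>, f) \<and>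
        (\<Delta>', \<pi> f, \<Delta>, inv \<pi>) \<in> gluings T) \<and>
     (\<forall>\<Delta> f \<Delta>\<^sub>1 \<pi>\<^sub>1 \<Delta>\<^sub>2 \<pi>\<^sub>2. (\<Delta>, f, \<Delta>\<^sub>1, \<pi>\<^sub>1) \<in> gluings T \<longrightarrow> (\<Delta>, f, \<Delta>\<^sub>2, \<pi>\<^sub>2) \<in> gluings T \<longrightarrow>
        \<Delta>\<^sub>1 = \<Delta>\<^sub>2 \<and> \<pi>\<^sub>1 = \<pi>\<^sub>2)"

text \<open>An arc is an unordered pair of faces, so that both directions of a gluing give the same arc.\<close>

definition dual_graph :: "'a triangulation \<Rightarrow> ('a, ('a \<times> 4) set) multigraph" where
  "dual_graph T =
     \<lparr> nodes = tets T,
       arcs = {{(\<Delta>, f), (\<Delta>', \<pi> f)} |\<Delta> f \<Delta>' \<pi>. (\<Delta>, f, \<Delta>', \<pi>) \<in> gluings T},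
       ends = (\<lambda>e. fst ` e) \<rparr>"


section \<open>The underlying space\<close>

definition std_simplex :: "(real^4) set" where
  "std_simplex = {x. (\<forall>i. 0 \<le> x $ i) \<and> (\<Sum>i\<in>UNIV. x $ i) = 1}"

definition facet :: "4 \<Rightarrow> (real^4) set" where
  "facet f = {x \<in> std_simplex. x $ f = 0}"

definition tets_space :: "'a triangulation \<Rightarrow> ('a \<times> (real^4)) topology" where
  "tets_space T = prod_topology (discrete_topology (tets T)) (top_of_set std_simplex)"

definition glued_points :: "'a triangulation \<Rightarrow> 'a \<times> (real^4) \<Rightarrow> 'a \<times> (real^4) \<Rightarrow> bool" where
  "glued_points T p q \<longleftrightarrow>
     (\<exists>\<Delta> f \<Delta>' \<pi> x. (\<Delta>, f, \<Delta>', \<pi>) \<in> gluings T \<and> x \<in> facet f \<and>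
        p = (\<Delta>, x) \<and> q = (\<Delta>', \<chi> i. x $ (inv \<pi> i)))"

definition point_class :: "'a triangulation \<Rightarrow> 'a \<times> (real^4) \<Rightarrow> ('a \<times> (real^4)) set" where
  "point_class T p = {q. equivclp (glued_points T) p q}"

definition underlying_space :: "'a triangulation \<Rightarrow> ('a \<times> (real^4)) set topology" where
  "underlying_space T = topology (\<lambda>U. U \<subseteq> point_class T ` topspace (tets_space T) \<and>
     openin (tets_space T) {p \<in> topspace (tets_space T). point_class T p \<in> U})"

lemma openin_underlying_space:
  "openin (underlying_space T) U \<longleftrightarrow> U \<subseteq> point_class T ` topspace (tets_space T) \<and>
     openin (tets_space T) {p \<in> topspace (tets_space T). point_class T p \<in> U}"
proof -
  let ?X = "tets_space T" and ?q = "point_class T"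
  have "istopology (\<lambda>U. U \<subseteq> ?q ` topspace ?X \<and> openin ?X {p \<in> topspace ?X. ?q p \<in> U})"
    unfolding istopology_def
  proof (intro conjI allI impI)
    fix U V
    assume U: "U \<subseteq> ?q ` topspace ?X \<and> openin ?X {p \<in> topspace ?X. ?q p \<in> U}"
      and V: "V \<subseteq> ?q ` topspace ?X \<and> openin ?X {p \<in> topspace ?X. ?q p \<in> V}"
    show "U \<inter> V \<subseteq> ?q ` topspace ?X" using U by blast
    have "{p \<in> topspace ?X. ?q p \<in> U \<inter> V} =
        {p \<in> topspace ?X. ?q p \<in> U} \<inter> {p \<in> topspace ?X. ?q p \<in> V}" by blast
    then show "openin ?X {p \<in> topspace ?X. ?q p \<in> U \<inter> V}"
      using U V by (simp only: openin_Int)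
  next
    fix \<K>
    assume K: "\<forall>U\<in>\<K>. U \<subseteq> ?q ` topspace ?X \<and> openin ?X {p \<in> topspace ?X. ?q p \<in> U}"
    then show "\<Union>\<K> \<subseteq> ?q ` topspace ?X" by blast
    have "{p \<in> topspace ?X. ?q p \<in> \<Union>\<K>} = (\<Union>U\<in>\<K>. {p \<in> topspace ?X. ?q p \<in> U})" by blast
    moreover have "openin ?X (\<Union>U\<in>\<K>. {p \<in> topspace ?X. ?q p \<in> U})"
      by (rule openin_Union) (use K in blast)
    ultimately show "openin ?X {p \<in> topspace ?X. ?q p \<in> \<Union>\<K>}" by (simp only:)
  qed
  then show ?thesis
    unfolding underlying_space_def by (simp add: topology_inverse')
qed

lemma quotient_map_underlying_space:
  "quotient_map (tets_space T) (underlying_space T) (point_class T)"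
proof -
  let ?P = "topspace (tets_space T)" and ?q = "point_class T"
  have "{p \<in> ?P. ?q p \<in> ?q ` ?P} = ?P" by blast
  then have op: "openin (underlying_space T) (?q ` ?P)"
    by (simp only: openin_underlying_space openin_topspace subset_refl simp_thms)
  have "topspace (underlying_space T) \<subseteq> ?q ` ?P"
    using openin_topspace[of "underlying_space T"] by (simp only: openin_underlying_space)
  with openin_subset[OF op] have "?q ` ?P = topspace (underlying_space T)"
    by (rule subset_antisym)
  then show ?thesis
    unfolding quotient_map_def openin_underlying_space by simp
qed

definition vertex_points :: "'a triangulation \<Rightarrow> ('a \<times> (real^4)) set set" where
  "vertex_points T = {point_class T (\<Delta>, axis v 1) |\<Delta> v. \<Delta> \<in> tets T}"

definition boundary_points :: "'a triangulation \<Rightarrow> ('a \<times> (real^4)) set set" where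
  "boundary_points T = {point_class T (\<Delta>, x) |\<Delta> f x.
     \<Delta> \<in> tets T \<and> x \<in> facet f \<and> \<not> (\<exists>\<Delta>' \<pi>. (\<Delta>, f, \<Delta>', \<pi>) \<in> gluings T)}"

definition chart_at :: "'b topology \<Rightarrow> 'c topology \<Rightarrow> 'b \<Rightarrow> bool" where
  "chart_at X Y x \<longleftrightarrow> (\<exists>U V. openin X U \<and> x \<in> U \<and> openin Y V \<and>
     subtopology X U homeomorphic_space subtopology Y V)"

text \<open>The argument \<open>H\<close> is the closed half-space on which the manifold is modelled.\<close>

definition manifold_with_boundary :: "'c::topological_space set \<Rightarrow> 'b topology \<Rightarrow> bool" where
  "manifold_with_boundary H X \<longleftrightarrow> Hausdorff_space X \<and>
     (\<exists>\<B>. countable \<B> \<and> (\<forall>U. openin X U \<longleftrightarrow> (\<exists>\<C>\<subseteq>\<B>. U = \<Union>\<C>))) \<and>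
     (\<forall>x\<in>topspace X. chart_at X (top_of_set H) x)"

text \<open>\<open>V\<close> is the set of ideal vertices, empty unless the triangulation is ideal.\<close>

definition triangulates_3_manifold :: "'a triangulation \<Rightarrow> bool" where
  "triangulates_3_manifold T \<longleftrightarrow> (\<exists>V\<subseteq>vertex_points T.
     manifold_with_boundary {x::real^3. 0 \<le> x $ 1}
       (subtopology (underlying_space T) (topspace (underlying_space T) - V)))"


section \<open>Normal surfaces\<close>

text \<open>A curvilinear disc is the image of a flat one under a homeomorphism of the tetrahedron that
  maps every facet, hence every edge and vertex, to itself. The flat disc lies half way between
  the face spanned by \<open>A\<close> and the face spanned by the remaining vertices: it is a triangle if
  \<open>A\<close> is a single vertex and a quad if \<open>A\<close> is a pair of vertices.\<close>

definition normal_disc :: "4 set \<Rightarrow> (real^4) set \<Rightarrow> bool" where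
  "normal_disc A D \<longleftrightarrow> (\<exists>h g. homeomorphism std_simplex std_simplex h g \<and>
     (\<forall>f. h ` facet f = facet f) \<and>
     D = h ` {x \<in> std_simplex. (\<Sum>i\<in>A. x $ i) = 1/2})"

definition normal_triangle :: "(real^4) set \<Rightarrow> bool" where
  "normal_triangle D \<longleftrightarrow> (\<exists>v. normal_disc {v} D)"

definition normal_quad :: "(real^4) set \<Rightarrow> bool" where
  "normal_quad D \<longleftrightarrow> (\<exists>a b. a \<noteq> b \<and> normal_disc {a, b} D)"

definition properly_embedded_surface :: "'a triangulation \<Rightarrow> ('a \<times> (real^4)) set set \<Rightarrow> bool" where
  "properly_embedded_surface T S \<longleftrightarrow>
     closedin (underlying_space T) S \<and>
     manifold_with_boundary {x::real^2. 0 \<le> x $ 1} (subtopology (underlying_space T) S) \<and>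
     (\<forall>p\<in>S. p \<in> boundary_points T \<longleftrightarrow>
        \<not> chart_at (subtopology (underlying_space T) S) (euclidean :: (real^2) topology) p)"

definition trace :: "'a triangulation \<Rightarrow> ('a \<times> (real^4)) set set \<Rightarrow> 'a \<Rightarrow> (real^4) set" where
  "trace T S \<Delta> = {x \<in> std_simplex. point_class T (\<Delta>, x) \<in> S}"

text \<open>Discs being closed and connected, a finite disjoint union of them has them as its
  connected components.\<close>

definition normal_surface :: "'a triangulation \<Rightarrow> ('a \<times> (real^4)) set set \<Rightarrow> bool" where
  "normal_surface T S \<longleftrightarrow> properly_embedded_surface T S \<and>
     (\<forall>\<Delta>\<in>tets T. finite (components (trace T S \<Delta>)) \<and>
        (\<forall>D\<in>components (trace T S \<Delta>). normal_triangle D \<or> normal_quad D))"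

definition contains_quad :: "'a triangulation \<Rightarrow> ('a \<times> (real^4)) set set \<Rightarrow> 'a \<Rightarrow> bool" where
  "contains_quad T S \<Delta> \<longleftrightarrow> (\<exists>D\<in>components (trace T S \<Delta>). normal_quad D)"


section \<open>Crushing\<close>

text \<open>The cells into which \<open>S\<close> cuts the tetrahedron \<open>\<Delta>\<close>.\<close>

definition cells :: "'a triangulation \<Rightarrow> ('a \<times> (real^4)) set set \<Rightarrow> 'a \<Rightarrow> (real^4) set set" where
  "cells T S \<Delta> = components (std_simplex - trace T S \<Delta>)"

text \<open>\<open>S\<close> cuts the facet opposite \<open>f\<close> along arcs, each of which is collapsed to a point. A piece of
  the facet becomes a triangle if it meets all three edges of the facet, and a bigon if it meets
  only two of them. Each facet has exactly one piece of the former kind, so a triangular face of a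
  cell is determined by \<open>(\<Delta>, f)\<close>. Its corners are labelled by the vertices \<open>v \<noteq> f\<close>: the corner \<open>v\<close>
  is the vertex \<open>v\<close> itself or a collapsed arc that cuts \<open>v\<close> off.\<close>

definition has_triangular_face ::
  "'a triangulation \<Rightarrow> ('a \<times> (real^4)) set set \<Rightarrow> 'a \<Rightarrow> (real^4) set \<Rightarrow> 4 \<Rightarrow> bool" where
  "has_triangular_face T S \<Delta> C f \<longleftrightarrow>
     (\<exists>F\<in>components (facet f - trace T S \<Delta>). F \<subseteq> C \<and> (\<forall>e. e \<noteq> f \<longrightarrow> F \<inter> facet e \<noteq> {}))"

text \<open>\<open>identified T S \<Delta> f \<Delta>' \<pi>\<close>: once the non-tetrahedron cells are flattened, the triangular
  faces at \<open>(\<Delta>, f)\<close> and \<open>(\<Delta>', \<pi> f)\<close> coincide, and so do the corners \<open>v\<close> and \<open>\<pi> v\<close> for \<open>v \<noteq> f\<close>.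
  Footballs have only bigon faces, which are flattened to edges, so they identify no triangles.
  In a tetrahedron containing quads, the cells with triangular faces are the two triangular purses.
  A purse with triangular faces at \<open>f\<close> and \<open>g\<close> is flattened onto a single triangle fixing the common
  edge of the two faces, whence the remaining corners, \<open>g\<close> of the former face and \<open>f\<close> of the
  latter, coincide.\<close>

inductive identified ::
  "'a triangulation \<Rightarrow> ('a \<times> (real^4)) set set \<Rightarrow> 'a \<Rightarrow> 4 \<Rightarrow> 'a \<Rightarrow> (4 \<Rightarrow> 4) \<Rightarrow> bool"
  for T S where
  refl: "identified T S \<Delta> f \<Delta> id"
| gluing: "(\<Delta>, f, \<Delta>', \<pi>) \<in> gluings T \<Longrightarrow> identified T S \<Delta> f \<Delta>' \<pi>"
| purse: "\<Delta> \<in> tets T \<Longrightarrow> contains_quad T S \<Delta> \<Longrightarrow> C \<in> cells T S \<Delta> \<Longrightarrow> f \<noteq> g \<Longrightarrow>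
    has_triangular_face T S \<Delta> C f \<Longrightarrow> has_triangular_face T S \<Delta> C g \<Longrightarrow>
    identified T S \<Delta> f \<Delta> (id(f := g, g := f))"
| trans: "identified T S \<Delta> f \<Delta>' \<pi> \<Longrightarrow> identified T S \<Delta>' (\<pi> f) \<Delta>'' \<rho> \<Longrightarrow>
    identified T S \<Delta> f \<Delta>'' (\<rho> \<circ> \<pi>)"

text \<open>Tetrahedra of the result are joined along faces only, so that tetrahedra meeting only along
  pinched edges or vertices are separated.\<close>

definition crush :: "'a triangulation \<Rightarrow> ('a \<times> (real^4)) set set \<Rightarrow> 'a triangulation" where
  "crush T S =
     (let R = {\<Delta> \<in> tets T. \<not> contains_quad T S \<Delta>} in
      \<lparr> tets = R,
        gluings = {(\<Delta>, f, \<Delta>', \<pi>). \<Delta> \<in> R \<and> \<Delta>' \<in> R \<and> identified T S \<Delta> f \<Delta>' \<pi> \<and>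
          (\<Delta>', \<pi> f) \<noteq> (\<Delta>, f)} \<rparr>)"

definition crushing_step :: "'a triangulation \<Rightarrow> 'a triangulation \<Rightarrow> bool" where
  "crushing_step T T' \<longleftrightarrow> (\<exists>S. normal_surface T S \<and> T' = crush T S)"

end

theory Submission
  imports Defs
begin

text \<open>A quad in a tetrahedron separates two vertices from the other two, so the purses join its
  four faces in two pairs. Hence, after any number of crushings, every gluing is a trail through
  the original dual graph whose interior nodes are crushed tetrahedra, and every crushed
  tetrahedron is passed at most twice. Given a tree decomposition of the original dual graph,
  replace each crushed tetrahedron in every bag by one chosen end of each of the at most two
  trails through it. Bags of size at most \<open>k + 1\<close> become bags of size at most \<open>2 (k + 1)\<close>, and
  \<open>2 k + 1 \<le> 6 k\<close> unless \<open>k = 0\<close>, when all arcs are loops and no trail leaves a tetrahedron.\<close>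

section \<open>Tree decompositions\<close>

text \<open>Adjacency is symmetric, so walks from the base \<open>c\<close> to two nodes combine
  into a walk between them.\<close>

lemma connected_onI_base:
  assumes "\<And>\<tau>. \<tau> \<in> N \<Longrightarrow> (\<lambda>a b. a \<in> N \<and> b \<in> N \<and> {a, b} \<in> E)\<^sup>*\<^sup>* c \<tau>"
  shows "connected_on E N"
proof -
  let ?r = "\<lambda>a b. a \<in> N \<and> b \<in> N \<and> {a, b} \<in> E"
  have "symp ?r\<^sup>*\<^sup>*"
    by (rule symp_rtranclp) (auto simp: symp_def insert_commute)
  then show ?thesis
    unfolding connected_on_def using assms by (meson rtranclp_trans sympD)
qed

lemma connected_on_reach_mono:
  assumes "connected_on E M" "M \<subseteq> N" "u \<in> M" "v \<in> M"
  shows "(\<lambda>a b. a \<in> N \<and> b \<in> N \<and> {a, b} \<in> E)\<^sup>*\<^sup>* u v"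
proof -
  have "(\<lambda>a b. a \<in> M \<and> b \<in> M \<and> {a, b} \<in> E)\<^sup>*\<^sup>* u v"
    using assms by (simp add: connected_on_def)
  then show ?thesis
    by (rule rtranclp_mono[THEN predicate2D, rotated]) (use assms in auto)
qed

lemma treewidth_le_width:
  fixes N :: "nat set"
  shows "tree_decomposition G N E B \<Longrightarrow> treewidth G \<le> width N B"
  unfolding treewidth_def by (rule Least_le) blast

text \<open>The tree with a single node, whose bag holds everything, is a decomposition; hence the
  \<open>LEAST\<close> ranges over a nonempty set of widths and its value is attained.\<close>

lemma treewidth_attained:
  assumes "\<And>e. e \<in> arcs G \<Longrightarrow> ends G e \<subseteq> nodes G"
  obtains N :: "nat set" and E B where "tree_decomposition G N E B" "width N B = treewidth G"
proof -
  have "\<not> is_cycle {} xs" for xs :: "nat list"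
    by (cases xs) (auto simp: is_cycle_def)
  then have "is_tree {0::nat} {}"
    by (auto simp: is_tree_def connected_on_def)
  then have "tree_decomposition G {0::nat} {} (\<lambda>_. nodes G)"
    using assms by (auto simp: tree_decomposition_def connected_on_def)
  then have "\<exists>w (N :: nat set) E B. tree_decomposition G N E B \<and> width N B = w"
    by blast
  from LeastI_ex[OF this] show ?thesis
    using that unfolding treewidth_def by blast
qed

text \<open>If all bags are empty, truncated subtraction gives width 0 and the bound still
  holds.\<close>

lemma card_bag_le:
  assumes "tree_decomposition G N E B" "\<tau> \<in> N"
  shows "card (B \<tau>) \<le> width N B + 1"
proof -
  have "finite N"
    using assms by (simp add: tree_decomposition_def is_tree_def)
  then have "card (B \<tau>) \<le> Max ((\<lambda>\<tau>. card (B \<tau>)) ` N)"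
    using assms by (intro Max_ge) auto
  then show ?thesis
    by (simp add: width_def)
qed

lemma width_le:
  assumes "tree_decomposition G N E B" "\<And>\<tau>. \<tau> \<in> N \<Longrightarrow> card (B \<tau>) \<le> k + 1"
  shows "width N B \<le> k"
proof -
  have "finite N" "N \<noteq> {}"
    using assms by (simp_all add: tree_decomposition_def is_tree_def)
  then have "Max ((\<lambda>\<tau>. card (B \<tau>)) ` N) \<le> k + 1"
    using assms by (intro Max.boundedI) auto
  then show ?thesis
    by (simp add: width_def)
qed


section \<open>Purses pair the faces of a crushed tetrahedron\<close>

text \<open>These are the perfect matchings of the four faces: two orbits \<open>{s, p s}\<close>
  and \<open>{t, p t}\<close> can cover four elements only if the involution has no fixed
  point.\<close>

definition pairing :: "(4 \<Rightarrow> 4) \<Rightarrow> bool" where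
  "pairing p \<longleftrightarrow> (\<forall>f. p (p f) = f) \<and> (\<exists>s t. \<forall>f. f \<in> {s, p s, t, p t})"

lemma UNIV_4_complement_pair:
  fixes a b :: 4
  assumes "a \<noteq> b"
  obtains c d where "UNIV = {a, b, c, d}" "distinct [a, b, c, d]"
proof -
  have "card (UNIV - {a, b}) = 2"
    using assms by (subst card_Diff_subset) auto
  then obtain c d where cd: "UNIV - {a, b} = {c, d}" "c \<noteq> d"
    by (auto simp: card_2_iff)
  then have "UNIV = {a, b, c, d}" "c \<notin> {a, b}" "d \<notin> {a, b}"
    by blast+
  with that show ?thesis
    using assms cd by auto
qed

text \<open>Intermediate value theorem: after straightening the disc by \<open>g\<close>, the
  coordinate sum over \<open>A\<close> is 0 at \<open>x\<close> and 1 at \<open>y\<close>, and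
  \<open>D\<close> is exactly its level set at 1/2.\<close>

lemma normal_disc_separates:
  assumes D: "normal_disc A D" and C: "connected C" "C \<subseteq> std_simplex" "C \<inter> D = {}"
    and x: "x \<in> C" "\<And>i. i \<in> A \<Longrightarrow> x \<in> facet i"
    and y: "y \<in> C" "\<And>i. i \<notin> A \<Longrightarrow> y \<in> facet i"
  shows False
proof -
  obtain h g where hg: "homeomorphism std_simplex std_simplex h g"
    and facet: "\<And>f. h ` facet f = facet f"
    and D_eq: "D = h ` {x \<in> std_simplex. (\<Sum>i\<in>A. x $ i) = 1/2}"
    using D unfolding normal_disc_def by blast
  let ?\<phi> = "\<lambda>x. \<Sum>i\<in>A. g x $ i"
  have g_simplex: "g z \<in> std_simplex" if "z \<in> std_simplex" for z
    using homeomorphism_image2[OF hg] that by blast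
  \<comment> \<open>Since \<open>h\<close> maps each facet onto itself, so does its inverse
    \<open>g\<close>.\<close>
  have g_facet: "g z $ i = 0" if "z \<in> facet i" for z i
  proof -
    have "z \<in> h ` facet i"
      using that by (simp only: facet)
    then obtain w where w: "w \<in> facet i" "z = h w"
      by blast
    then have "g z = w"
      using homeomorphism_apply1[OF hg, of w] by (simp add: facet_def)
    with w show ?thesis
      by (simp add: facet_def)
  qed
  have "continuous_on C g"
    using homeomorphism_cont2[OF hg] C(2) by (rule continuous_on_subset)
  then have "continuous_on C ?\<phi>"
    by (intro continuous_intros)
  then have conn: "connected (?\<phi> ` C)"
    using C(1) by (rule connected_continuous_image)
  have x0: "?\<phi> x = 0"
    by (rule sum.neutral) (use x(2) g_facet in blast)
  have "g y $ i = 0" if "i \<notin> A" for i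
    using that y(2) g_facet by blast
  then have "?\<phi> y = (\<Sum>i\<in>UNIV. g y $ i)"
    by (intro sum.mono_neutral_left) auto
  also have "\<dots> = 1"
    using g_simplex[of y] C(2) y(1) by (auto simp: std_simplex_def)
  finally have y1: "?\<phi> y = 1" .
  have "0 \<in> ?\<phi> ` C" "1 \<in> ?\<phi> ` C"
    using x(1) x0 y(1) y1 by (metis imageI)+
  from connectedD_interval[OF conn this, of "1/2"] obtain z where z: "z \<in> C" "?\<phi> z = 1/2"
    by auto
  have "z \<in> std_simplex"
    using z(1) C(2) by blast
  then have "g z \<in> std_simplex" "h (g z) = z"
    using g_simplex homeomorphism_apply2[OF hg] by blast+
  then have "z \<in> D"
    unfolding D_eq using z(2) by (metis (mono_tags, lifting) imageI mem_Collect_eq)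
  with z(1) C(3) show False
    by blast
qed

text \<open>The quad separates the edge \<open>ab\<close> from the edge \<open>cd\<close>. A cell
  with triangular faces opposite one vertex of each pair would meet both edges, so \<open>p\<close>
  can be taken to swap the two vertices on each side of the quad.\<close>

lemma quad_pairing:
  assumes "contains_quad T S \<Delta>"
  obtains p where "pairing p"
    and "\<And>C f g. \<lbrakk>C \<in> cells T S \<Delta>; f \<noteq> g; has_triangular_face T S \<Delta> C f;
      has_triangular_face T S \<Delta> C g\<rbrakk> \<Longrightarrow> g = p f"
proof -
  obtain D a b where D: "D \<in> components (trace T S \<Delta>)" "a \<noteq> b" "normal_disc {a, b} D"
    using assms unfolding contains_quad_def normal_quad_def by blast
  obtain c d where U: "UNIV = {a, b, c, d}" and dist: "distinct [a, b, c, d]"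
    using UNIV_4_complement_pair[OF \<open>a \<noteq> b\<close>] by blast
  have all: "i = a \<or> i = b \<or> i = c \<or> i = d" for i
    using UNIV_I[of i] unfolding U by simp
  define p where "p f = (if f = a then b else if f = b then a else if f = c then d else c)" for f
  have "pairing p"
    unfolding pairing_def
  proof (intro conjI allI exI)
    show "p (p f) = f" for f
      using all[of f] dist by (auto simp: p_def)
    show "f \<in> {a, p a, c, p c}" for f
      using all[of f] dist by (auto simp: p_def)
  qed
  moreover have "g = p f" if C: "C \<in> cells T S \<Delta>" and "f \<noteq> g"
    and f: "has_triangular_face T S \<Delta> C f" and g: "has_triangular_face T S \<Delta> C g" for C f g
  proof (rule ccontr)
    assume "g \<noteq> p f"
    then have mixed: "f \<in> {a, b} \<and> g \<in> {c, d} \<or> f \<in> {c, d} \<and> g \<in> {a, b}"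
      using all[of f] all[of g] \<open>f \<noteq> g\<close> dist by (auto simp: p_def)
    \<comment> \<open>A triangular face meets all three edges of its facet, in particular the one
      shared with \<open>facet j\<close>.\<close>
    have edge: "\<exists>x\<in>C. x \<in> facet i \<and> x \<in> facet j"
      if ij: "has_triangular_face T S \<Delta> C i" "j \<noteq> i" for i j
    proof -
      obtain F where "F \<in> components (facet i - trace T S \<Delta>)" "F \<subseteq> C" "F \<inter> facet j \<noteq> {}"
        using ij unfolding has_triangular_face_def by blast
      then show ?thesis
        using in_components_subset by blast
    qed
    have "has_triangular_face T S \<Delta> C a \<or> has_triangular_face T S \<Delta> C b"
      "has_triangular_face T S \<Delta> C c \<or> has_triangular_face T S \<Delta> C d"
      using mixed f g by auto
    then have "\<exists>x\<in>C. x \<in> facet a \<and> x \<in> facet b" "\<exists>y\<in>C. y \<in> facet c \<and> y \<in> facet d"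
      using edge[of a b] edge[of b a] edge[of c d] edge[of d c] dist by auto
    then obtain x y where x: "x \<in> C" "x \<in> facet a" "x \<in> facet b"
      and y: "y \<in> C" "y \<in> facet c" "y \<in> facet d"
      by blast
    have "connected C" "C \<subseteq> std_simplex - trace T S \<Delta>"
      using C in_components_connected in_components_subset unfolding cells_def by blast+
    moreover have "D \<subseteq> trace T S \<Delta>"
      using D(1) by (rule in_components_subset)
    ultimately have C': "connected C" "C \<subseteq> std_simplex" "C \<inter> D = {}"
      by blast+
    have "x \<in> facet i" if "i \<in> {a, b}" for i
      using that x by blast
    moreover have "y \<in> facet i" if "i \<notin> {a, b}" for i
      using that all[of i] y by blast
    ultimately show False
      using normal_disc_separates[OF D(3) C' x(1) _ y(1)] by blast
  qed
  ultimately show ?thesis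
    using that by blast
qed


section \<open>Trails through crushed tetrahedra\<close>

text \<open>In the following, \<open>R\<close> is the set of surviving tetrahedra and \<open>m\<close> gives the pairings of the
  faces of the crushed ones.\<close>

definition glued :: "'a triangulation \<Rightarrow> 'a \<times> 4 \<Rightarrow> 'a \<times> 4 \<Rightarrow> bool" where
  "glued T x y \<longleftrightarrow> (\<exists>\<pi>. (fst x, snd x, fst y, \<pi>) \<in> gluings T \<and> snd y = \<pi> (snd x))"

definition across ::
  "'a triangulation \<Rightarrow> 'a set \<Rightarrow> ('a \<Rightarrow> 4 \<Rightarrow> 4) \<Rightarrow> 'a \<times> 4 \<Rightarrow> 'a \<times> 4 \<Rightarrow> bool" where
  "across T R m x y \<longleftrightarrow> fst x \<in> tets T - R \<and> y = (fst x, m (fst x) (snd x))"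

definition linked ::
  "'a triangulation \<Rightarrow> 'a set \<Rightarrow> ('a \<Rightarrow> 4 \<Rightarrow> 4) \<Rightarrow> 'a \<times> 4 \<Rightarrow> 'a \<times> 4 \<Rightarrow> bool" where
  "linked T R m = (\<lambda>x y. glued T x y \<or> across T R m x y)\<^sup>*\<^sup>*"

text \<open>Removing further tetrahedra only adds \<open>across\<close> steps, as long as the
  pairings chosen earlier are kept.\<close>

lemma linked_mono:
  assumes "linked T R m x y" "R' \<subseteq> R" "\<And>w. w \<in> tets T - R \<Longrightarrow> m' w = m w"
  shows "linked T R' m' x y"
  using assms(1) unfolding linked_def
  by (rule rtranclp_mono[THEN predicate2D, rotated]) (use assms(2,3) in \<open>auto simp: across_def\<close>)

lemma linked_step: "glued T x y \<or> across T R m x y \<Longrightarrow> linked T R m x y"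
  by (simp add: linked_def r_into_rtranclp)

lemma linked_trans: "linked T R m x y \<Longrightarrow> linked T R m y z \<Longrightarrow> linked T R m x z"
  by (simp add: linked_def)

text \<open>The invariant of a sequence of crushings. Gluings of the current triangulation are
  traced back to the original \<open>T\<close>, so the bound is obtained once and does not grow with
  the number of crushings.\<close>

definition smooths :: "'a triangulation \<Rightarrow> ('a \<Rightarrow> 4 \<Rightarrow> 4) \<Rightarrow> 'a triangulation \<Rightarrow> bool" where
  "smooths T m T' \<longleftrightarrow> tets T' \<subseteq> tets T \<and> (\<forall>w\<in>tets T - tets T'. pairing (m w)) \<and>
     (\<forall>\<Delta> f \<Delta>' \<pi>. (\<Delta>, f, \<Delta>', \<pi>) \<in> gluings T' \<longrightarrow>
        \<Delta> \<in> tets T' \<and> \<Delta>' \<in> tets T' \<and> (\<Delta>', \<pi> f) \<noteq> (\<Delta>, f) \<and>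
        linked T (tets T') m (\<Delta>, f) (\<Delta>', \<pi> f))"

lemma smooths_refl: "triangulation T \<Longrightarrow> smooths T m T"
  unfolding smooths_def triangulation_def
  by (auto intro!: linked_step simp: glued_def)

text \<open>Each generator of \<open>identified\<close> is a trail in \<open>T\<close>: an old
  gluing is one by the invariant, and a purse is a single passage across a newly crushed
  tetrahedron.\<close>

lemma smooths_crush:
  assumes "smooths T m T'"
  obtains m' where "smooths T m' (crush T' S)"
proof -
  let ?T'' = "crush T' S"
  have "\<exists>p. pairing p \<and> (\<forall>C f g. C \<in> cells T' S \<Delta> \<longrightarrow> f \<noteq> g \<longrightarrow>
      has_triangular_face T' S \<Delta> C f \<longrightarrow> has_triangular_face T' S \<Delta> C g \<longrightarrow> g = p f)"
    if "contains_quad T' S \<Delta>" for \<Delta>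
    using quad_pairing[OF that] by metis
  then obtain q where q: "\<And>\<Delta>. contains_quad T' S \<Delta> \<Longrightarrow> pairing (q \<Delta>)"
    "\<And>\<Delta> C f g. \<lbrakk>contains_quad T' S \<Delta>; C \<in> cells T' S \<Delta>; f \<noteq> g;
      has_triangular_face T' S \<Delta> C f; has_triangular_face T' S \<Delta> C g\<rbrakk> \<Longrightarrow> g = q \<Delta> f"
    by metis
  \<comment> \<open>Tetrahedra crushed earlier keep their pairing, those crushed now get that of
    their quad. \<open>across\<close> reads \<open>m'\<close> only at crushed tetrahedra, so its
    values at survivors may be arbitrary.\<close>
  define m' where "m' w = (if w \<in> tets T' then q w else m w)" for w
  have tets: "tets ?T'' = {\<Delta> \<in> tets T'. \<not> contains_quad T' S \<Delta>}"
    by (simp add: crush_def Let_def)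
  have sub: "tets T' \<subseteq> tets T"
    using assms by (simp add: smooths_def)
  have linked: "linked T (tets ?T'') m' (\<Delta>, f) (\<Delta>', \<pi> f)"
    if "identified T' S \<Delta> f \<Delta>' \<pi>" for \<Delta> f \<Delta>' \<pi>
    using that
  proof induction
    case (refl \<Delta> f)
    then show ?case
      by (simp add: linked_def)
  next
    case (gluing \<Delta> f \<Delta>' \<pi>)
    then have "linked T (tets T') m (\<Delta>, f) (\<Delta>', \<pi> f)"
      using assms by (simp add: smooths_def)
    then show ?case
      by (rule linked_mono) (auto simp: tets m'_def)
  next
    case (purse \<Delta> C f g)
    then have "g = m' \<Delta> f"
      using q(2) by (simp add: m'_def)
    then show ?case
      using purse sub by (intro linked_step) (auto simp: across_def tets)
  next
    case (trans \<Delta> f \<Delta>' \<pi> \<Delta>'' \<rho>)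
    then show ?case
      using linked_trans by fastforce
  qed
  have "smooths T m' ?T''"
    unfolding smooths_def
  proof (intro conjI ballI allI impI)
    show "tets ?T'' \<subseteq> tets T"
      using sub by (auto simp: tets)
    show "pairing (m' w)" if "w \<in> tets T - tets ?T''" for w
      using that assms q(1) by (auto simp: m'_def tets smooths_def)
  qed (use linked in \<open>auto simp: crush_def Let_def\<close>)
  then show ?thesis
    using that by blast
qed

lemma smooths_crushing_steps:
  assumes "triangulation T" "crushing_step\<^sup>*\<^sup>* T T'"
  shows "\<exists>m. smooths T m T'"
  using assms(2)
proof induction
  case base
  then show ?case
    using smooths_refl[OF assms(1)] by blast
next
  case (step T' T'')
  then show ?case
    by (metis crushing_step_def smooths_crush)
qed


section \<open>Treewidth of a smoothing\<close>

locale smoothing =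
  fixes T :: "'a triangulation" and m :: "'a \<Rightarrow> 4 \<Rightarrow> 4" and T' :: "'a triangulation"
  assumes triangulation: "triangulation T"
    and smooths: "smooths T m T'"
begin

abbreviation R :: "'a set" where "R \<equiv> tets T'"
abbreviation gl :: "'a \<times> 4 \<Rightarrow> 'a \<times> 4 \<Rightarrow> bool" where "gl \<equiv> glued T"
abbreviation ac :: "'a \<times> 4 \<Rightarrow> 'a \<times> 4 \<Rightarrow> bool" where "ac \<equiv> across T R m"
abbreviation lk :: "'a \<times> 4 \<Rightarrow> 'a \<times> 4 \<Rightarrow> bool" where "lk \<equiv> linked T R m"

text \<open>Leads from the face by which a trail enters a crushed tetrahedron to the face by which
  it enters the next tetrahedron.\<close>

definition hop :: "'a \<times> 4 \<Rightarrow> 'a \<times> 4 \<Rightarrow> bool" where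
  "hop = ac OO gl"

definition on_trail :: "'a \<times> 4 \<Rightarrow> 'a \<times> 4 \<Rightarrow> bool" where
  "on_trail = gl OO hop\<^sup>*\<^sup>*"

section \<open>Symmetry and determinism of the moves along a trail\<close>

lemma finite_tets: "finite (tets T)"
  using triangulation by (simp add: triangulation_def)

lemma R_subset: "R \<subseteq> tets T"
  using smooths by (simp add: smooths_def)

lemma pairing_m: "w \<in> tets T - R \<Longrightarrow> pairing (m w)"
  using smooths by (simp add: smooths_def)

lemma gl_in_tets: "gl x y \<Longrightarrow> fst x \<in> tets T \<and> fst y \<in> tets T"
  using triangulation unfolding glued_def triangulation_def by blast

lemma gl_sym:
  assumes "gl x y"
  shows "gl y x"
proof -
  obtain \<pi> where \<pi>: "(fst x, snd x, fst y, \<pi>) \<in> gluings T" "snd y = \<pi> (snd x)"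
    using assms by (auto simp: glued_def)
  then have "bij \<pi>" "(fst y, \<pi> (snd x), fst x, inv \<pi>) \<in> gluings T"
    using triangulation unfolding triangulation_def by blast+
  then show ?thesis
    using \<pi> by (auto simp: glued_def bij_is_inj)
qed

lemma gl_unique: "gl x y \<Longrightarrow> gl x z \<Longrightarrow> y = z"
  using triangulation unfolding glued_def triangulation_def by (metis prod.expand)

lemma ac_sym: "ac x y \<Longrightarrow> ac y x"
  using pairing_m by (auto simp: across_def pairing_def)

lemma ac_unique: "ac x y \<Longrightarrow> ac x z \<Longrightarrow> y = z"
  by (simp add: across_def)

lemma ac_removed: "ac x y \<Longrightarrow> fst x \<notin> R \<and> fst y \<notin> R \<and> fst y = fst x"
  by (simp add: across_def)

lemma lk_sym: "lk x y \<Longrightarrow> lk y x"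
proof -
  have "symp (\<lambda>x y. gl x y \<or> ac x y)\<^sup>*\<^sup>*"
    by (rule symp_rtranclp) (auto intro!: sympI intro: gl_sym ac_sym)
  then show "lk x y \<Longrightarrow> lk y x"
    unfolding linked_def by (rule sympD)
qed

lemma on_trail_hop: "on_trail x y \<Longrightarrow> hop y z \<Longrightarrow> on_trail x z"
  unfolding on_trail_def by (auto intro: rtranclp.rtrancl_into_rtrancl)

lemma hop_removed: "hop x y \<Longrightarrow> fst x \<notin> R"
  by (auto simp: hop_def dest: ac_removed)

lemma hop_unique: "hop x y \<Longrightarrow> hop x z \<Longrightarrow> y = z"
  by (auto simp: hop_def dest: ac_unique gl_unique)

text \<open>Hops are deterministic and none starts at a survivor, so a survivor can only be the end
  of the walk.\<close>

lemma hops_to_survivor_unique: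
  assumes "hop\<^sup>*\<^sup>* s x" "hop\<^sup>*\<^sup>* s y" "fst x \<in> R" "fst y \<in> R"
  shows "x = y"
  using assms
proof (induction rule: converse_rtranclp_induct)
  case base
  then show ?case
    by (metis converse_rtranclpE hop_removed)
next
  case (step s t)
  then have "hop\<^sup>*\<^sup>* t y"
    by (metis converse_rtranclpE hop_removed hop_unique)
  then show ?case
    using step by blast
qed

lemma on_trail_survivor_unique:
  assumes "on_trail x y" "on_trail x z" "fst y \<in> R" "fst z \<in> R"
  shows "y = z"
  using assms hops_to_survivor_unique gl_unique unfolding on_trail_def by blast

text \<open>A surviving face has no partner across its tetrahedron, so its class is the single trail that
  starts there.\<close>

lemma linked_survivor_cases:
  assumes "fst x \<in> R" "lk x y"
  shows "y = x \<or> on_trail x y \<or> (\<exists>y'. on_trail x y' \<and> ac y' y)"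
  using assms(2) unfolding linked_def
proof (induction rule: rtranclp_induct)
  case base
  then show ?case
    by blast
next
  case (step y z)
  consider "y = x" | "on_trail x y" | y' where "on_trail x y'" "ac y' y"
    using step.IH by blast
  then show ?case
  proof cases
    case 1
    then have "gl x z"
      using step.hyps assms(1) ac_removed by blast
    then show ?thesis
      by (auto simp: on_trail_def)
  next
    case 2
    then obtain s where s: "gl x s" "hop\<^sup>*\<^sup>* s y"
      by (auto simp: on_trail_def)
    show ?thesis
    proof (cases "ac y z")
      case True
      then show ?thesis
        using 2 by blast
    next
      case False
      then have "gl y z"
        using step.hyps by blast
      \<comment> \<open>The trail entered \<open>y\<close> by a gluing, which \<open>gl y z\<close>
        retraces: \<open>z\<close> is \<open>x\<close> or the exit face of the preceding
        tetrahedron.\<close>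
      from s(2) show ?thesis
      proof (cases rule: rtranclp.cases)
        case rtrancl_refl
        then show ?thesis
          using s \<open>gl y z\<close> gl_sym gl_unique by blast
      next
        case (rtrancl_into_rtrancl y'')
        then show ?thesis
          using s \<open>gl y z\<close> gl_sym gl_unique unfolding hop_def on_trail_def by blast
      qed
    qed
  next
    case 3
    show ?thesis
    proof (cases "ac y z")
      case True
      then show ?thesis
        using 3 ac_sym ac_unique by blast
    next
      case False
      \<comment> \<open>Here \<open>y\<close> is the exit face paired with the entry face
        \<open>y'\<close>, so the gluing at \<open>y\<close> completes a hop.\<close>
      then have "hop y' z"
        using 3 step.hyps by (auto simp: hop_def)
      then show ?thesis
        using 3 on_trail_hop by blast
    qed
  qed
qed

lemma linked_survivors:
  assumes "fst x \<in> R" "fst y \<in> R" "lk x y" "x \<noteq> y"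
  shows "on_trail x y"
  using linked_survivor_cases[OF assms(1,3)] assms ac_removed by blast

lemma on_trail_linked: "on_trail x y \<Longrightarrow> lk x y"
proof -
  assume "on_trail x y"
  then obtain s where "gl x s" "hop\<^sup>*\<^sup>* s y"
    by (auto simp: on_trail_def)
  from this(2,1) show ?thesis
  proof induction
    case base
    then show ?case
      by (simp add: linked_step)
  next
    case (step y z)
    then obtain y' where y': "lk x y" "ac y y'" "gl y' z"
      by (auto simp: hop_def)
    have "lk y y'" "lk y' z"
      using y' by (simp_all add: linked_step)
    with y'(1) show ?case
      by (blast intro: linked_trans)
  qed
qed

section \<open>Surviving representatives of trails, and the new bags\<close>

definition valid :: "'a \<times> 4 \<Rightarrow> bool" where
  "valid y \<longleftrightarrow> (\<exists>u\<in>R. \<exists>f. lk (u, f) y)"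

text \<open>The chosen end of the trail through \<open>y\<close>; meaningful only if
  \<open>y\<close> is \<open>valid\<close>, which fails for instance on closed trails through
  crushed tetrahedra.\<close>

definition rep :: "'a \<times> 4 \<Rightarrow> 'a" where
  "rep y = (SOME u. u \<in> R \<and> (\<exists>f. lk (u, f) y))"

lemma linked_valid: "lk x y \<Longrightarrow> valid x \<Longrightarrow> valid y"
  unfolding valid_def using linked_trans by blast

text \<open>The predicate under \<open>SOME\<close> depends only on the class of the face under
  \<open>lk\<close>, so the choice is the same all along a trail.\<close>

lemma linked_rep:
  assumes "lk x y"
  shows "rep x = rep y"
proof -
  have "lk z x \<longleftrightarrow> lk z y" for z
    using assms linked_trans lk_sym by blast
  then show ?thesis
    by (simp add: rep_def)
qed

lemma survivor_valid: "fst x \<in> R \<Longrightarrow> valid x"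
  by (cases x) (auto simp: valid_def linked_def)

lemma linked_survivor:
  assumes "lk x y" "fst x \<in> R"
  shows "valid y" "rep y = rep x"
  using linked_valid[OF assms(1) survivor_valid[OF assms(2)]] linked_rep[OF assms(1)] by simp_all

lemma rep_valid:
  assumes "valid y"
  shows "rep y \<in> R" "\<exists>f. lk (rep y, f) y"
proof -
  have "\<exists>u. u \<in> R \<and> (\<exists>f. lk (u, f) y)"
    using assms by (auto simp: valid_def)
  from someI_ex[OF this] show "rep y \<in> R" "\<exists>f. lk (rep y, f) y"
    by (simp_all add: rep_def)
qed

definition bag :: "('n \<Rightarrow> 'a set) \<Rightarrow> 'n \<Rightarrow> 'a set" where
  "bag B \<tau> = (B \<tau> \<inter> R) \<union> {rep (w, f) |w f. w \<in> B \<tau> - R \<and> valid (w, f)}"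

lemma rep_in_bag: "fst y \<in> B \<tau> \<Longrightarrow> fst y \<notin> R \<Longrightarrow> valid y \<Longrightarrow> rep y \<in> bag B \<tau>"
  by (cases y) (auto simp: bag_def)

text \<open>Paired faces lie on the same trail, so the four faces of a crushed tetrahedron have at
  most two representatives.\<close>

lemma card_bag:
  assumes "B \<tau> \<subseteq> tets T"
  shows "card (bag B \<tau>) \<le> 2 * card (B \<tau>)"
proof -
  have fin: "finite (B \<tau>)"
    using assms finite_tets finite_subset by blast
  have "\<exists>s t. \<forall>f. rep (w, f) \<in> {rep (w, s), rep (w, t)}" if "w \<in> B \<tau> - R" for w
  proof -
    have w: "w \<in> tets T - R"
      using that assms by blast
    have rep: "rep (w, m w f) = rep (w, f)" for f
      using w by (intro linked_rep[symmetric] linked_step) (simp add: across_def)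
    obtain s t where st: "\<And>f. f \<in> {s, m w s, t, m w t}"
      using pairing_m[OF w] unfolding pairing_def by blast
    have "rep (w, f) \<in> {rep (w, s), rep (w, t)}" for f
      using st[of f] rep by auto
    then show ?thesis
      by blast
  qed
  then obtain s t where st: "\<And>w f. w \<in> B \<tau> - R \<Longrightarrow> rep (w, f) \<in> {rep (w, s w), rep (w, t w)}"
    by metis
  have "bag B \<tau> \<subseteq> (B \<tau> \<inter> R) \<union> (\<Union>w\<in>B \<tau> - R. {rep (w, s w), rep (w, t w)})"
    using st unfolding bag_def by blast
  then have "card (bag B \<tau>) \<le> card ((B \<tau> \<inter> R) \<union> (\<Union>w\<in>B \<tau> - R. {rep (w, s w), rep (w, t w)}))"
    using fin by (intro card_mono) auto
  also have "\<dots> \<le> card (B \<tau> \<inter> R) + card (\<Union>w\<in>B \<tau> - R. {rep (w, s w), rep (w, t w)})"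
    by (rule card_Un_le)
  also have "card (\<Union>w\<in>B \<tau> - R. {rep (w, s w), rep (w, t w)})
      \<le> (\<Sum>w\<in>B \<tau> - R. card {rep (w, s w), rep (w, t w)})"
    using fin by (intro card_UN_le) auto
  also have "\<dots> \<le> (\<Sum>w\<in>B \<tau> - R. 2)"
    by (intro sum_mono) (simp add: card_insert_if)
  also have "card (B \<tau> \<inter> R) + \<dots> \<le> 2 * (card (B \<tau> \<inter> R) + card (B \<tau> - R))"
    by simp
  also have "card (B \<tau> \<inter> R) + card (B \<tau> - R) = card (B \<tau>)"
    using fin card_Int_Diff by metis
  finally show ?thesis
    by simp
qed

section \<open>Verification of the new tree decomposition\<close>

context
  fixes N :: "'n set" and E B
  assumes decomp: "tree_decomposition (dual_graph T) N E B"
begin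

lemma bag_subset_tets: "\<tau> \<in> N \<Longrightarrow> B \<tau> \<subseteq> tets T"
  using decomp by (simp add: tree_decomposition_def dual_graph_def)

lemma bag_covers_tet: "w \<in> tets T \<Longrightarrow> \<exists>\<tau>\<in>N. w \<in> B \<tau>"
  using decomp by (simp add: tree_decomposition_def dual_graph_def)

lemma bags_connected: "w \<in> tets T \<Longrightarrow> connected_on E {\<tau> \<in> N. w \<in> B \<tau>}"
  using decomp by (simp add: tree_decomposition_def dual_graph_def)

lemma bag_covers_gluing:
  assumes "gl x y"
  shows "\<exists>\<tau>\<in>N. fst x \<in> B \<tau> \<and> fst y \<in> B \<tau>"
proof -
  obtain \<pi> where \<pi>: "(fst x, snd x, fst y, \<pi>) \<in> gluings T" "snd y = \<pi> (snd x)"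
    using assms by (auto simp: glued_def)
  then have "{x, y} \<in> arcs (dual_graph T)"
    by (simp add: dual_graph_def) (metis prod.collapse)
  then obtain \<tau> where "\<tau> \<in> N" "ends (dual_graph T) {x, y} \<subseteq> B \<tau>"
    using decomp unfolding tree_decomposition_def by blast
  then show ?thesis
    by (auto simp: dual_graph_def)
qed

text \<open>The bags containing \<open>u\<close> are the old subtree of \<open>u\<close> together
  with the subtrees of the crushed tetrahedra on trails represented by \<open>u\<close>. Consecutive
  tetrahedra of a trail share a bag, so these subtrees chain together.\<close>

lemma new_bags_connected:
  assumes u: "u \<in> R"
  shows "connected_on E {\<tau> \<in> N. u \<in> bag B \<tau>}"
proof -
  define M where "M = {\<tau> \<in> N. u \<in> bag B \<tau>}"
  define r where "r = (\<lambda>a b. a \<in> M \<and> b \<in> M \<and> {a, b} \<in> E)\<^sup>*\<^sup>*"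
  \<comment> \<open>If every old bag of \<open>w\<close> now contains \<open>u\<close>, the old
    subtree of \<open>w\<close> lies inside \<open>M\<close> and stays connected there.\<close>
  have within: "r \<rho> \<tau>"
    if "w \<in> tets T" "\<And>\<upsilon>. w \<in> B \<upsilon> \<Longrightarrow> u \<in> bag B \<upsilon>" "\<rho> \<in> N" "w \<in> B \<rho>" "\<tau> \<in> N" "w \<in> B \<tau>"
    for w \<rho> \<tau>
    unfolding r_def
    by (rule connected_on_reach_mono[OF bags_connected[OF that(1)]]) (use that in \<open>auto simp: M_def\<close>)
  have uT: "u \<in> tets T"
    using u R_subset by blast
  then obtain \<sigma> where \<sigma>: "\<sigma> \<in> N" "u \<in> B \<sigma>"
    using bag_covers_tet by blast
  have old: "r \<sigma> \<tau>" if "\<tau> \<in> N" "u \<in> B \<tau>" for \<tau>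
    using uT _ \<sigma> that by (rule within) (simp add: bag_def u)
  \<comment> \<open>One gluing along a trail: \<open>\<rho>\<close> is a bag common to both
    tetrahedra, reached through that of \<open>x\<close> and continued inside the subtree of that of
    \<open>y\<close>.\<close>
  have extend: "r \<sigma> \<tau>"
    if "gl x y" "fst y \<notin> R" "valid y" "rep y = u" "\<tau> \<in> N" "fst y \<in> B \<tau>"
      and IH: "\<And>\<tau>. \<lbrakk>\<tau> \<in> N; fst x \<in> B \<tau>\<rbrakk> \<Longrightarrow> r \<sigma> \<tau>" for x y \<tau>
  proof -
    obtain \<rho> where \<rho>: "\<rho> \<in> N" "fst x \<in> B \<rho>" "fst y \<in> B \<rho>"
      using bag_covers_gluing[OF \<open>gl x y\<close>] by blast
    have "u \<in> bag B \<upsilon>" if "fst y \<in> B \<upsilon>" for \<upsilon>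
      using rep_in_bag[of y B \<upsilon>, OF that \<open>fst y \<notin> R\<close> \<open>valid y\<close>] \<open>rep y = u\<close> by simp
    moreover have "fst y \<in> tets T"
      using gl_in_tets \<open>gl x y\<close> by blast
    ultimately have "r \<rho> \<tau>"
      using within \<rho> that(5,6) by blast
    with IH[OF \<rho>(1,2)] show ?thesis
      unfolding r_def by (rule rtranclp_trans)
  qed
  have trail: "r \<sigma> \<tau>"
    if "hop\<^sup>*\<^sup>* s y" "gl x s" "fst x = u" "rep x = u" "fst y \<notin> R" "\<tau> \<in> N" "fst y \<in> B \<tau>" for s x y \<tau>
    using that
  proof (induction arbitrary: \<tau> rule: rtranclp_induct)
    case base
    have "lk x s"
      using base.prems(1) linked_step by blast
    then have "valid s" "rep s = u"
      using base.prems u linked_survivor by simp_all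
    moreover have "r \<sigma> \<rho>" if "\<rho> \<in> N" "fst x \<in> B \<rho>" for \<rho>
      using old that base.prems(2) by blast
    ultimately show ?case
      using base.prems(1,4-6) extend by blast
  next
    case (step y z)
    then obtain y' where y': "ac y y'" "gl y' z"
      by (auto simp: hop_def)
    have "on_trail x y"
      using step.hyps(1) step.prems(1) unfolding on_trail_def by blast
    then have "lk x z"
      using step.hyps(2) on_trail_hop on_trail_linked by blast
    then have "valid z" "rep z = u"
      using step.prems u linked_survivor by simp_all
    moreover have "r \<sigma> \<rho>" if "\<rho> \<in> N" "fst y' \<in> B \<rho>" for \<rho>
      using that step.prems ac_removed[OF y'(1)] by (intro step.IH) simp_all
    ultimately show ?case
      using y'(2) step.prems(4-6) extend by blast
  qed
  have "r \<sigma> \<tau>" if \<tau>: "\<tau> \<in> M" for \<tau>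
  proof (cases "u \<in> B \<tau>")
    case True
    then show ?thesis
      using old \<tau> by (simp add: M_def)
  next
    case False
    then obtain w f where wf: "w \<in> B \<tau>" "w \<notin> R" "valid (w, f)" "rep (w, f) = u"
      using \<tau> by (auto simp: bag_def M_def)
    then obtain f' where f': "lk (u, f') (w, f)"
      using rep_valid(2)[OF wf(3)] by blast
    then have rep: "rep (u, f') = u"
      using linked_rep wf(4) by blast
    \<comment> \<open>The face \<open>(w, f)\<close> may be the exit face of \<open>w\<close>;
      \<open>y\<close> is then the entry face paired with it, to which the induction along hops
      applies.\<close>
    obtain y where y: "on_trail (u, f') y" "fst y = w"
    proof -
      have "(w, f) \<noteq> (u, f')"
        using u wf(2) by blast
      with linked_survivor_cases[OF _ f'] u consider "on_trail (u, f') (w, f)"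
        | y' where "on_trail (u, f') y'" "ac y' (w, f)"
        by auto
      then show ?thesis
        using that ac_removed by cases fastforce+
    qed
    then obtain s where "gl (u, f') s" "hop\<^sup>*\<^sup>* s y"
      by (auto simp: on_trail_def)
    then show ?thesis
      using trail[of s y "(u, f')" \<tau>] rep wf \<tau> y(2) by (simp add: M_def)
  qed
  then have "connected_on E M"
    unfolding r_def by (rule connected_onI_base)
  then show ?thesis
    by (simp add: M_def)
qed

text \<open>The trail is followed from the end \<open>y\<close> that was not chosen. Its first
  gluing gives a bag shared with the next tetrahedron, which is either that of \<open>x\<close> or a
  crushed one replaced by the representative \<open>fst x\<close>.\<close>

lemma new_bag_covers_half:
  assumes x: "fst x \<in> R" and y: "fst y \<in> R" and "lk x y" "x \<noteq> y" "rep x = fst x"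
  shows "\<exists>\<tau>\<in>N. fst x \<in> bag B \<tau> \<and> fst y \<in> bag B \<tau>"
proof -
  have trail: "on_trail y x"
    using assms linked_survivors lk_sym by blast
  then obtain s where s: "gl y s"
    by (auto simp: on_trail_def)
  then obtain \<tau> where \<tau>: "\<tau> \<in> N" "fst y \<in> B \<tau>" "fst s \<in> B \<tau>"
    using bag_covers_gluing by blast
  have "fst x \<in> bag B \<tau>"
  proof (cases "fst s \<in> R")
    case True
    have "on_trail y s"
      using s by (auto simp: on_trail_def)
    then have "s = x"
      using on_trail_survivor_unique trail True x by blast
    then show ?thesis
      using \<tau> x by (simp add: bag_def)
  next
    case False
    have "lk y s"
      using s by (simp add: linked_step)
    then have "valid s" "rep s = fst x"
      using assms y linked_survivor linked_rep by metis+
    then show ?thesis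
      using \<tau> False rep_in_bag by metis
  qed
  then show ?thesis
    using \<tau> y by (auto simp: bag_def)
qed

lemma new_bag_covers:
  assumes x: "fst x \<in> R" and y: "fst y \<in> R" and xy: "lk x y" "x \<noteq> y"
  shows "\<exists>\<tau>\<in>N. fst x \<in> bag B \<tau> \<and> fst y \<in> bag B \<tau>"
proof -
  obtain f where f: "lk (rep x, f) x" "rep x \<in> R"
    using rep_valid survivor_valid[OF x] by blast
  \<comment> \<open>If \<open>(rep x, f)\<close> differs from \<open>x\<close>, then it and
    \<open>y\<close> are both surviving faces on the trail from \<open>x\<close>, hence
    equal.\<close>
  have "(rep x, f) = x \<or> (rep x, f) = y"
    using linked_survivors[OF x _ lk_sym[OF f(1)]] linked_survivors[OF x y xy] f(2) y
      on_trail_survivor_unique by (metis fst_conv)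
  then consider "rep x = fst x" | "rep y = fst y"
    using linked_rep[OF xy(1)] by (metis fst_conv)
  then show ?thesis
    using new_bag_covers_half assms lk_sym by cases metis+
qed

lemma new_tree_decomposition: "tree_decomposition (dual_graph T') N E (bag B)"
  unfolding tree_decomposition_def
proof (intro conjI ballI)
  show "is_tree N E"
    using decomp by (simp add: tree_decomposition_def)
  show "bag B \<tau> \<subseteq> nodes (dual_graph T')" for \<tau>
    using rep_valid(1) by (auto simp: bag_def dual_graph_def)
  show "\<exists>\<tau>\<in>N. u \<in> bag B \<tau>" if "u \<in> nodes (dual_graph T')" for u
    using that R_subset bag_covers_tet[of u] by (auto simp: dual_graph_def bag_def)
  show "\<exists>\<tau>\<in>N. ends (dual_graph T') e \<subseteq> bag B \<tau>" if arc: "e \<in> arcs (dual_graph T')" for e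
  proof -
    obtain \<Delta> f \<Delta>' \<pi> where e: "e = {(\<Delta>, f), (\<Delta>', \<pi> f)}" "(\<Delta>, f, \<Delta>', \<pi>) \<in> gluings T'"
      using arc by (auto simp: dual_graph_def)
    then have "\<Delta> \<in> R" "\<Delta>' \<in> R" "(\<Delta>', \<pi> f) \<noteq> (\<Delta>, f)" "lk (\<Delta>, f) (\<Delta>', \<pi> f)"
      using smooths unfolding smooths_def by blast+
    then show ?thesis
      using new_bag_covers[of "(\<Delta>, f)" "(\<Delta>', \<pi> f)"] e by (auto simp: dual_graph_def)
  qed
  show "connected_on E {\<tau> \<in> N. u \<in> bag B \<tau>}" if "u \<in> nodes (dual_graph T')" for u
    using that new_bags_connected by (simp add: dual_graph_def)
qed

text \<open>With bags of size at most one, every gluing joins a tetrahedron to itself, so no trail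
  from a survivor reaches a crushed tetrahedron and no representative is inserted.\<close>

lemma card_new_bag_le_1:
  assumes "\<And>\<tau>. \<tau> \<in> N \<Longrightarrow> card (B \<tau>) \<le> 1" "\<tau> \<in> N"
  shows "card (bag B \<tau>) \<le> 1"
proof -
  have fin: "finite (B \<upsilon>)" if "\<upsilon> \<in> N" for \<upsilon>
    using bag_subset_tets[OF that] finite_tets finite_subset by blast
  have loop: "fst x = fst y" if "gl x y" for x y
    using bag_covers_gluing[OF that] assms(1) fin
    by (metis One_nat_def card_le_Suc0_iff_eq)
  have "fst x = fst y" if "lk x y" for x y
    using that unfolding linked_def
  proof induction
    case (step y z)
    then show ?case
      using loop ac_removed by metis
  qed simp
  then have "\<not> valid (w, f)" if "w \<notin> R" for w f
    using that by (fastforce simp: valid_def)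
  then have "bag B \<tau> \<subseteq> B \<tau>"
    by (auto simp: bag_def)
  then show ?thesis
    using card_mono[OF fin] assms le_trans by blast
qed

end

section \<open>The bound on the treewidth\<close>

theorem treewidth_smoothing: "treewidth (dual_graph T') \<le> 6 * treewidth (dual_graph T)"
proof -
  have "ends (dual_graph T) e \<subseteq> nodes (dual_graph T)" if "e \<in> arcs (dual_graph T)" for e
    using that triangulation unfolding triangulation_def
    by (fastforce simp: dual_graph_def)
  then obtain N :: "nat set" and E B where decomp: "tree_decomposition (dual_graph T) N E B"
    and k: "width N B = treewidth (dual_graph T)"
    using treewidth_attained by blast
  let ?k = "treewidth (dual_graph T)"
  have old: "card (B \<tau>) \<le> ?k + 1" if "\<tau> \<in> N" for \<tau>
    using card_bag_le[OF decomp that] k by simp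
  have new: "card (bag B \<tau>) \<le> 6 * ?k + 1" if "\<tau> \<in> N" for \<tau>
  \<comment> \<open>The estimate \<open>2 * (?k + 1) \<le> 6 * ?k + 1\<close> holds from
    \<open>?k = 1\<close> on but fails at 0, where doubling the bags is too coarse.\<close>
  proof (cases "?k = 0")
    case True
    then show ?thesis
      using card_new_bag_le_1[OF decomp _ that] old by simp
  next
    case False
    then show ?thesis
      using card_bag[of B \<tau>] bag_subset_tets[OF decomp that] old[OF that] by linarith
  qed
  have "tree_decomposition (dual_graph T') N E (bag B)"
    by (rule new_tree_decomposition[OF decomp])
  then show ?thesis
    using treewidth_le_width width_le new le_trans by blast
qed

end

theorem corollary3p5:
  fixes T T' :: "'a triangulation"
  assumes "triangulation T"
    and "triangulates_3_manifold T"
    and "crushing_step\<^sup>*\<^sup>* T T'"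
  shows "treewidth (dual_graph T') \<le> 6 * treewidth (dual_graph T)"
proof -
  obtain m where "smooths T m T'"
    using smooths_crushing_steps assms(1,3) by blast
  then interpret smoothing T m T'
    using assms(1) by unfold_locales
  show ?thesis
    by (rule treewidth_smoothing)
qed

end
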